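(* Let $K_{\mathcal{U}}$ be the classical Bergman kernel on $\mathcal{U}$ and let $K_U:U\times U\to\mathbb{H}$ be its extension as a slice-regular function. Then 1. $K_U(q,s)=\overline{K_U(s,q)}$ for all $q,s\in U$; 2. $K_U(\cdot,\cdot)$ is slice-regular in the first variable and slice-antiregular in the second one; 3. $K_U$ is a reproducing kernel, i.e. for every slice-regular $f:U\to\mathbb{H}$ with $\int_{U\cap\mathbb{C}_v}|f|^2d\mu<\infty$, $$f(q)=\int_{U\cap\mathbb{C}_v}K_U(q,s)f(s)\,d\mu(s)$$ for every $v\in\mathbb{S}$ and every $q\in U$.
   Context: $\mathbb{H}$ is the algebra of quaternions, $\mathbb{S}=\{q\in\mathbb{H}: q^2=-1\}$, and $\iota$ is the imaginary unit of $\mathbb{C}$. For $v\in\mathbb{S}$, $\mathbb{C}_v=\{x+vy:x,y\in\mathbb{R}\}$ and $\rho_v:\mathbb{C}\to\mathbb{C}_v$, $\rho_v(x+\iota y)=x+vy$. $\mathcal{U}\subset\mathbb{C}\cong\mathbb{R}^2$ is an open domain (connected) invariant under complex conjugation, and $U=\{x+vy: x+\iota y\in\mathcal{U},\ v\in\mathbb{S}\}$. $\mu$ is the Lebesgue measure on $\mathcal{U}$, and also on $U\cap\mathbb{C}_v\cong\mathcal{U}$ via $\rho_v$. A (left) slice-regular function on $U$ is $f:U\to\mathbb{H}$ with $f(x+vy)=\alpha(x,y)+v\beta(x,y)$ for all $x+\iota y\in\mathcal{U}$, $v\in\mathbb{S}$, where $\alpha,\beta:\mathcal{U}\to\mathbb{H}$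 are differentiable with $\alpha(x,-y)=\alpha(x,y)$, $\beta(x,-y)=-\beta(x,y)$, $\partial_x\alpha=\partial_y\beta$, $\partial_y\alpha=-\partial_x\beta$. A function $g$ on $U$ is called slice-antiregular if $s\mapsto\overline{g(s)}$ is left slice-regular. The classical Bergman kernel $K_{\mathcal{U}}(z,w)$ is the reproducing kernel of the space of square-integrable holomorphic functions on $\mathcal{U}$: $h(z)=\int_{\mathcal{U}}K_{\mathcal{U}}(z,w)h(w)\,d\mu(w)$. Its slice-regular extension $K_U$ is defined as follows: for $s=\rho_v(w)\in U\cap\mathbb{C}_v$, $K_U(\cdot,s)$ is the unique left slice-regular function on $U$ with $K_U(\rho_v(z),\rho_v(w))=\rho_v(K_{\mathcal{U}}(z,w))$ for all $z\in\mathcal{U}$. Explicitly, for $q=x+uy$, $u\in\mathbb{S}$, $z=x+\iota y$, $$K_U(q,s)=\tfrac12\big[\rho_v(K_{\mathcal{U}}(z,w))+\rho_v(K_{\mathcal{U}}(\bar z,w))\big]+u\,\tfrac12\,v\big[\rho_v(K_{\mathcal{U}}(\bar z,w))-\rho_v(K_{\mathcal{U}}(z,w))\big].$$ (Where $K_{\mathcal{U}}(z,w)=\sum a_{nm}z^n\bar w^m$ with $a_{nm}\in\mathbb{R}$, this amounts to $K_U(q,s)=\sum a_{nm}q^n\bar s^m$.) *)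

theory Defs
  imports "HOL-Analysis.Analysis"
begin

section \<open>The algebra of quaternions\<close>

datatype quat = Quat (Re_q: real) (Im_i: real) (Im_j: real) (Im_k: real)

lemma quat_eq_iff:
  "p = q \<longleftrightarrow> Re_q p = Re_q q \<and> Im_i p = Im_i q \<and> Im_j p = Im_j q \<and> Im_k p = Im_k q"
  by (cases p; cases q) simp

instantiation quat :: ring_1
begin

definition "0 = Quat 0 0 0 0"
definition "1 = Quat 1 0 0 0"
definition "p + q = Quat (Re_q p + Re_q q) (Im_i p + Im_i q) (Im_j p + Im_j q) (Im_k p + Im_k q)"
definition "- p = Quat (- Re_q p) (- Im_i p) (- Im_j p) (- Im_k p)"
definition "p - q = Quat (Re_q p - Re_q q) (Im_i p - Im_i q) (Im_j p - Im_j q) (Im_k p - Im_k q)"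
definition "p * q = Quat
  (Re_q p * Re_q q - Im_i p * Im_i q - Im_j p * Im_j q - Im_k p * Im_k q)
  (Re_q p * Im_i q + Im_i p * Re_q q + Im_j p * Im_k q - Im_k p * Im_j q)
  (Re_q p * Im_j q - Im_i p * Im_k q + Im_j p * Re_q q + Im_k p * Im_i q)
  (Re_q p * Im_k q + Im_i p * Im_j q - Im_j p * Im_i q + Im_k p * Re_q q)"

instance
  by standard
    (simp_all add: zero_quat_def one_quat_def plus_quat_def uminus_quat_def minus_quat_def
      times_quat_def algebra_simps)

end

lemma quat_sel_ring [simp]:
  "Re_q 0 = 0" "Im_i 0 = 0" "Im_j 0 = 0" "Im_k 0 = 0"
  "Re_q 1 = 1" "Im_i 1 = 0" "Im_j 1 = 0" "Im_k 1 = 0"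
  "Re_q (p + q) = Re_q p + Re_q q" "Im_i (p + q) = Im_i p + Im_i q"
  "Im_j (p + q) = Im_j p + Im_j q" "Im_k (p + q) = Im_k p + Im_k q"
  "Re_q (- p) = - Re_q p" "Im_i (- p) = - Im_i p" "Im_j (- p) = - Im_j p" "Im_k (- p) = - Im_k p"
  "Re_q (p - q) = Re_q p - Re_q q" "Im_i (p - q) = Im_i p - Im_i q"
  "Im_j (p - q) = Im_j p - Im_j q" "Im_k (p - q) = Im_k p - Im_k q"
  by (simp_all add: zero_quat_def one_quat_def plus_quat_def uminus_quat_def minus_quat_def)

lemma quat_sel_times:
  "Re_q (p * q) = Re_q p * Re_q q - Im_i p * Im_i q - Im_j p * Im_j q - Im_k p * Im_k q"
  "Im_i (p * q) = Re_q p * Im_i q + Im_i p * Re_q q + Im_j p * Im_k q - Im_k p * Im_j q"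
  "Im_j (p * q) = Re_q p * Im_j q - Im_i p * Im_k q + Im_j p * Re_q q + Im_k p * Im_i q"
  "Im_k (p * q) = Re_q p * Im_k q + Im_i p * Im_j q - Im_j p * Im_i q + Im_k p * Re_q q"
  by (simp_all add: times_quat_def)

instantiation quat :: real_algebra_1
begin

definition "scaleR r q = Quat (r * Re_q q) (r * Im_i q) (r * Im_j q) (r * Im_k q)"

lemma quat_sel_scaleR [simp]:
  "Re_q (r *\<^sub>R q) = r * Re_q q" "Im_i (r *\<^sub>R q) = r * Im_i q"
  "Im_j (r *\<^sub>R q) = r * Im_j q" "Im_k (r *\<^sub>R q) = r * Im_k q"
  by (simp_all add: scaleR_quat_def)

instance
  by standard (simp_all add: quat_eq_iff quat_sel_times algebra_simps)

end

lemma quat_sel_of_real [simp]: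
  "Re_q (of_real r) = r" "Im_i (of_real r) = 0" "Im_j (of_real r) = 0" "Im_k (of_real r) = 0"
  by (simp_all add: of_real_def)

instantiation quat :: real_inner
begin

definition "inner p q =
  Re_q p * Re_q q + Im_i p * Im_i q + Im_j p * Im_j q + Im_k p * Im_k q"
definition "norm (q::quat) = sqrt (inner q q)"
definition "sgn (q::quat) = q /\<^sub>R norm q"
definition "dist (p::quat) q = norm (p - q)"
definition "(uniformity :: (quat \<times> quat) filter) =
  (INF e\<in>{0<..}. principal {(x, y). dist x y < e})"
definition "open (S::quat set) \<longleftrightarrow>
  (\<forall>x\<in>S. eventually (\<lambda>(x', y). x' = x \<longrightarrow> y \<in> S) uniformity)"

instance
proof
  fix p q r :: quat and a :: real and S :: "quat set"
  show "inner p q = inner q p" "inner (p + q) r = inner p r + inner q r"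
    "inner (a *\<^sub>R p) q = a * inner p q"
    by (simp_all add: inner_quat_def algebra_simps)
  show "0 \<le> inner p p" by (simp add: inner_quat_def)
  have *: "inner p p = (Re_q p)\<^sup>2 + (Im_i p)\<^sup>2 + (Im_j p)\<^sup>2 + (Im_k p)\<^sup>2"
    by (simp add: inner_quat_def power2_eq_square)
  show "inner p p = 0 \<longleftrightarrow> p = 0"
    unfolding * by (auto simp: quat_eq_iff add_nonneg_eq_0_iff)
qed (fact norm_quat_def sgn_quat_def dist_quat_def uniformity_quat_def open_quat_def)+

end

definition qcnj :: "quat \<Rightarrow> quat" where
  "qcnj q = Quat (Re_q q) (- Im_i q) (- Im_j q) (- Im_k q)"

lemma quat_sel_qcnj [simp]:
  "Re_q (qcnj q) = Re_q q" "Im_i (qcnj q) = - Im_i q"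
  "Im_j (qcnj q) = - Im_j q" "Im_k (qcnj q) = - Im_k q"
  by (simp_all add: qcnj_def)

lemma quat_norm_square: "(norm q)\<^sup>2 = (Re_q q)\<^sup>2 + (Im_i q)\<^sup>2 + (Im_j q)\<^sup>2 + (Im_k q)\<^sup>2"
  by (simp add: norm_eq_sqrt_inner inner_quat_def power2_eq_square)

lemma quat_mult_qcnj:
  "q * qcnj q = of_real ((norm q)\<^sup>2)" "qcnj q * q = of_real ((norm q)\<^sup>2)"
  unfolding quat_norm_square
  by (simp_all add: quat_eq_iff quat_sel_times power2_eq_square
      del: of_real_power of_real_mult of_real_add)

instantiation quat :: real_normed_div_algebra
begin

definition "inverse (q::quat) = qcnj q /\<^sub>R (norm q)\<^sup>2"
definition "(p::quat) div q = p * inverse q"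

instance
proof
  fix p q :: quat
  show "q \<noteq> 0 \<Longrightarrow> inverse q * q = 1" "q \<noteq> 0 \<Longrightarrow> q * inverse q = 1"
    unfolding inverse_quat_def mult_scaleR_left mult_scaleR_right quat_mult_qcnj
    by (simp_all add: of_real_def)
  show "inverse (0::quat) = 0"
    by (simp add: inverse_quat_def)
  show "p div q = p * inverse q"
    by (rule divide_quat_def)
  have "(norm (p * q))\<^sup>2 = (norm p * norm q)\<^sup>2"
    unfolding power_mult_distrib quat_norm_square quat_sel_times
    by (simp add: power2_eq_square algebra_simps)
  then show "norm (p * q) = norm p * norm q"
    by (simp add: power2_eq_iff_nonneg)
qed

end

instantiation quat :: euclidean_space
begin

definition "Basis = {Quat 1 0 0 0, Quat 0 1 0 0, Quat 0 0 1 0, Quat 0 0 0 1}"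

instance
proof
  show "(Basis::quat set) \<noteq> {}" "finite (Basis::quat set)"
    by (simp_all add: Basis_quat_def)
next
  fix u v :: quat
  assume "u \<in> Basis" "v \<in> Basis"
  then show "inner u v = (if u = v then 1 else 0)"
    unfolding Basis_quat_def by (elim insertE emptyE) (simp_all add: inner_quat_def)
next
  fix x :: quat
  show "(\<forall>u\<in>Basis. inner x u = 0) \<longleftrightarrow> x = 0"
    by (simp add: Basis_quat_def inner_quat_def quat_eq_iff[of x 0])
qed

end


section \<open>Slice-regular functions\<close>

definition quat_sphere :: "quat set" where
  "quat_sphere = {q. q\<^sup>2 = - 1}"

definition slice_plane :: "quat \<Rightarrow> quat set" where
  "slice_plane v = {of_real x + v * of_real y | x y. True}"

definition slice_map :: "quat \<Rightarrow> complex \<Rightarrow> quat" where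
  "slice_map v z = of_real (Re z) + v * of_real (Im z)"

definition circularization :: "complex set \<Rightarrow> quat set" where
  "circularization \<U> = {slice_map v z | v z. v \<in> quat_sphere \<and> z \<in> \<U>}"

text \<open>
  The total derivative of a function of \<open>x + \<i> y\<close>, evaluated at \<open>1\<close> and at \<open>\<i>\<close>, gives its
  partial derivatives in \<open>x\<close> and in \<open>y\<close>.
  Only the values of \<open>f\<close> on \<^term>\<open>circularization \<U>\<close> matter.
\<close>

definition slice_regular :: "complex set \<Rightarrow> (quat \<Rightarrow> quat) \<Rightarrow> bool" where
  "slice_regular \<U> f \<longleftrightarrow> (\<exists>\<alpha> \<beta> :: complex \<Rightarrow> quat.
     (\<forall>z\<in>\<U>. \<alpha> differentiable (at z) \<and> \<beta> differentiable (at z) \<and>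
       \<alpha> (cnj z) = \<alpha> z \<and> \<beta> (cnj z) = - \<beta> z \<and>
       frechet_derivative \<alpha> (at z) 1 = frechet_derivative \<beta> (at z) \<i> \<and>
       frechet_derivative \<alpha> (at z) \<i> = - frechet_derivative \<beta> (at z) 1) \<and>
     (\<forall>z\<in>\<U>. \<forall>v\<in>quat_sphere. f (slice_map v z) = \<alpha> z + v * \<beta> z))"

definition slice_antiregular :: "complex set \<Rightarrow> (quat \<Rightarrow> quat) \<Rightarrow> bool" where
  "slice_antiregular \<U> g \<longleftrightarrow> slice_regular \<U> (\<lambda>s. qcnj (g s))"

definition slice_measure :: "complex set \<Rightarrow> quat \<Rightarrow> quat measure" where
  "slice_measure \<U> v =
     distr (lebesgue_on \<U>) (restrict_space borel (circularization \<U> \<inter> slice_plane v)) (slice_map v)"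


section \<open>Bergman kernels\<close>

definition bergman_space :: "complex set \<Rightarrow> (complex \<Rightarrow> complex) set" where
  "bergman_space \<U> =
     {h. h holomorphic_on \<U> \<and> integrable (lebesgue_on \<U>) (\<lambda>z. (cmod (h z))\<^sup>2)}"

text \<open>
  \<open>K\<close> is the reproducing kernel of the Hilbert space \<^term>\<open>bergman_space \<U>\<close>: for every \<open>z\<close>, the
  evaluation at \<open>z\<close> is represented by the element \<open>\<lambda>w. cnj (K z w)\<close> of that space.
  This determines \<open>K\<close> on \<open>\<U> \<times> \<U>\<close>.
\<close>

definition is_bergman_kernel :: "complex set \<Rightarrow> (complex \<Rightarrow> complex \<Rightarrow> complex) \<Rightarrow> bool" where
  "is_bergman_kernel \<U> K \<longleftrightarrow>
     (\<forall>z\<in>\<U>. (\<lambda>w. cnj (K z w)) \<in> bergman_space \<U> \<and>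
       (\<forall>h\<in>bergman_space \<U>. h z = (\<integral>w. K z w * h w \<partial>lebesgue_on \<U>)))"

text \<open>
  \<open>f\<close> is the left slice-regular extension of \<open>K\<close> with second variable \<open>s\<close>. The condition is
  imposed for all representations \<open>s = slice_map v w\<close>: there are two of them, \<open>(v, w)\<close> and
  \<open>(- v, cnj w)\<close>, when \<open>s\<close> is not real, and one for every \<open>v\<close> when \<open>s\<close> is real.
\<close>

definition is_slice_extension ::
    "complex set \<Rightarrow> (complex \<Rightarrow> complex \<Rightarrow> complex) \<Rightarrow> quat \<Rightarrow> (quat \<Rightarrow> quat) \<Rightarrow> bool" where
  "is_slice_extension \<U> K s f \<longleftrightarrow> slice_regular \<U> f \<and>
     (\<forall>v\<in>quat_sphere. \<forall>w\<in>\<U>. slice_map v w = s \<longrightarrow>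
       (\<forall>z\<in>\<U>. f (slice_map v z) = slice_map v (K z w)))"

text \<open>
  The value at \<open>q\<close> of the slice-regular extension, which is unique as a function on
  \<^term>\<open>circularization \<U>\<close>; see \<open>is_slice_extension_formula\<close> and \<open>slice_extension_eq\<close> below.
\<close>

definition slice_extension ::
    "complex set \<Rightarrow> (complex \<Rightarrow> complex \<Rightarrow> complex) \<Rightarrow> quat \<Rightarrow> quat \<Rightarrow> quat" where
  "slice_extension \<U> K q s = (THE p. \<exists>f. is_slice_extension \<U> K s f \<and> f q = p)"

lemma is_slice_extension_formula:
  assumes sym: "\<forall>z\<in>\<U>. cnj z \<in> \<U>"
    and ext: "is_slice_extension \<U> K (slice_map v w) f"
    and v: "v \<in> quat_sphere" and w: "w \<in> \<U>" and u: "u \<in> quat_sphere" and z: "z \<in> \<U>"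
  shows "f (slice_map u z) =
    (1/2) *\<^sub>R (slice_map v (K z w) + slice_map v (K (cnj z) w)) +
    u * ((1/2) *\<^sub>R (v * (slice_map v (K (cnj z) w) - slice_map v (K z w))))"
proof -
  obtain \<alpha> \<beta> where f: "\<And>z v. z \<in> \<U> \<Longrightarrow> v \<in> quat_sphere \<Longrightarrow> f (slice_map v z) = \<alpha> z + v * \<beta> z"
    and par: "\<alpha> (cnj z) = \<alpha> z" "\<beta> (cnj z) = - \<beta> z"
    using ext z unfolding is_slice_extension_def slice_regular_def by blast
  have "slice_map v (K z w) = \<alpha> z + v * \<beta> z" "slice_map v (K (cnj z) w) = \<alpha> z - v * \<beta> z"
    using ext v w z bspec[OF sym z] f[OF z v] f[OF bspec[OF sym z] v] par
    unfolding is_slice_extension_def by auto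
  note * = this
  have "v * (\<alpha> z - v * \<beta> z - (\<alpha> z + v * \<beta> z)) = - 2 *\<^sub>R (v * v * \<beta> z)"
    by (simp add: algebra_simps scaleR_2)
  also have "v * v = - 1"
    using v by (simp add: quat_sphere_def power2_eq_square)
  finally have "v * (\<alpha> z - v * \<beta> z - (\<alpha> z + v * \<beta> z)) = 2 *\<^sub>R \<beta> z"
    by simp
  moreover have "\<alpha> z + v * \<beta> z + (\<alpha> z - v * \<beta> z) = 2 *\<^sub>R \<alpha> z"
    by (simp add: scaleR_2)
  ultimately show ?thesis
    by (simp only: * f[OF z u] scaleR_scaleR) simp
qed

lemma slice_extension_eq:
  assumes sym: "\<forall>z\<in>\<U>. cnj z \<in> \<U>"
    and ext: "is_slice_extension \<U> K s f"
    and s: "s \<in> circularization \<U>" and q: "q \<in> circularization \<U>"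
  shows "slice_extension \<U> K q s = f q"
proof -
  obtain v w u z where *: "v \<in> quat_sphere" "w \<in> \<U>" "s = slice_map v w"
    "u \<in> quat_sphere" "z \<in> \<U>" "q = slice_map u z"
    using s q unfolding circularization_def by blast
  have "g q = f q" if g: "is_slice_extension \<U> K s g" for g
    unfolding *(6) is_slice_extension_formula[OF sym g[unfolded *(3)] *(1,2,4,5)]
      is_slice_extension_formula[OF sym ext[unfolded *(3)] *(1,2,4,5)] ..
  then show ?thesis
    unfolding slice_extension_def using ext by (intro the_equality) blast+
qed

end

theory Submission
  imports Defs
begin

text \<open>
  Fix \<open>v \<in> \<S>\<close> and write \<open>\<rho>\<^sub>v\<close> for \<^term>\<open>slice_map v\<close>. Everything rests on two facts: the classical
  Bergman kernel inherits the symmetry of \<open>\<U>\<close> under conjugation, and a quaternion-valued function on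
  the slice of \<open>v\<close> that comes from a slice-regular function is holomorphic for the complex structure
  \<open>q \<mapsto> v q\<close> on the quaternions.

  Two reproducing kernels \<open>K\<close>, \<open>L\<close> of the Bergman space satisfy \<open>L(z,w) = cnj (K(w,z))\<close>, because each can
  be made to reproduce the sections of the other (\<open>bergman_kernels_adjoint\<close>). For \<open>L = K\<close> this is the
  Hermitian symmetry. Complex conjugation preserves Lebesgue measure, so \<open>cnj (K(cnj z, cnj w))\<close> is a
  reproducing kernel as well, and the same lemma gives \<open>K(cnj z, cnj w) = cnj (K(z,w))\<close>.

  The Hermitian symmetry makes \<open>K(\<cdot>,w)\<close> holomorphic, so its even and odd parts under conjugation,
  transported by \<open>\<rho>\<^sub>v\<close>, satisfy the Cauchy-Riemann equations and define a slice-regular function.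
  A point \<open>s\<close> can be written as \<open>\<rho>\<^sub>v(w)\<close> in several ways, and the reflection symmetry is exactly what
  makes the result independent of the choice; hence the slice-regular extension exists, with an explicit
  formula (\<open>slice_extension_kernel\<close>). Expanding the formula into real coefficients of \<open>1\<close>, \<open>u\<close>, \<open>v\<close>, \<open>u v\<close>
  turns the two symmetries of \<open>K\<close> into \<open>K\<^sub>U(q,s) = qcnj (K\<^sub>U(s,q))\<close>; antiregularity in \<open>s\<close> is then regularity
  in the first variable after a swap.

  For the reproducing property on a single slice, each vector \<open>c\<close> gives a functional
  \<open>q \<mapsto> \<langle>q,c\<rangle> + \<i> \<langle>q,v c\<rangle>\<close> from the quaternions to \<open>\<complex>\<close> that is complex linear for left multiplication by \<open>v\<close>.
  Composed with \<open>f \<circ> \<rho>\<^sub>v\<close> it yields an element of the classical Bergman space, to which \<open>K\<close> applies; the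
  real parts for all \<open>c\<close> determine the integral (\<open>slice_reproducing\<close>). The value at a point of another
  slice follows because \<open>K\<^sub>U(\<cdot>,s)\<close> and \<open>f\<close> obey the same representation formula: both are the same left linear
  combination of their values at \<open>\<rho>\<^sub>v(z)\<close> and \<open>\<rho>\<^sub>v(cnj z)\<close>.
\<close>

section \<open>Imaginary units and slices\<close>

lemma sphere_square: "v \<in> quat_sphere \<Longrightarrow> v * v = - 1"
  by (simp add: quat_sphere_def power2_eq_square)

lemma sphere_norm: "v \<in> quat_sphere \<Longrightarrow> norm v = 1"
proof -
  assume "v \<in> quat_sphere"
  then have "norm (v\<^sup>2) = 1" by (simp add: quat_sphere_def)
  then show ?thesis
    using power2_eq_1_iff[of "norm v"] norm_ge_zero[of v] by (simp add: norm_power)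
qed

text \<open>
  The imaginary components of \<open>v\<^sup>2\<close> are \<open>2 Re(v)\<close> times those of \<open>v\<close>. If \<open>Re(v)\<close> were nonzero, \<open>v\<close> would be
  real and its square nonnegative.
\<close>

lemma sphere_Re:
  assumes "v \<in> quat_sphere"
  shows "Re_q v = 0"
proof (rule ccontr)
  assume "Re_q v \<noteq> 0"
  moreover have e: "v * v = - 1" by (rule sphere_square[OF assms])
  ultimately have "Im_i v = 0" "Im_j v = 0" "Im_k v = 0"
    by (auto simp: quat_eq_iff quat_sel_times)
  with e have "Re_q v * Re_q v = - 1"
    by (auto simp: quat_eq_iff quat_sel_times)
  moreover have "0 \<le> Re_q v * Re_q v" by simp
  ultimately show False by linarith
qed

lemma qcnj_sphere: "v \<in> quat_sphere \<Longrightarrow> qcnj v = - v"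
  by (simp add: quat_eq_iff sphere_Re)

lemma qcnj_mult: "qcnj (p * q) = qcnj q * qcnj p"
  by (simp add: quat_eq_iff quat_sel_times)

lemma qcnj_simps [simp]:
  "qcnj (p + q) = qcnj p + qcnj q" "qcnj (p - q) = qcnj p - qcnj q" "qcnj (- p) = - qcnj p"
  "qcnj (r *\<^sub>R p) = r *\<^sub>R qcnj p"
  "qcnj (of_real r) = of_real r" "qcnj (qcnj p) = p"
  by (simp_all add: quat_eq_iff)

lemma continuous_on_qcnj: "continuous_on A g \<Longrightarrow> continuous_on A (\<lambda>x. qcnj (g x))"
proof -
  have "bounded_linear qcnj"
    by (simp add: linear_conv_bounded_linear[symmetric] linear_iff)
  then show "continuous_on A g \<Longrightarrow> continuous_on A (\<lambda>x. qcnj (g x))"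
    by (rule bounded_linear.continuous_on)
qed

lemma slice_map_scaleR: "slice_map v z = of_real (Re z) + Im z *\<^sub>R v"
  by (simp add: slice_map_def of_real_def)

lemma bounded_linear_slice_map: "bounded_linear (slice_map v)"
  by (simp add: linear_conv_bounded_linear[symmetric] linear_iff slice_map_scaleR algebra_simps
      of_real_def)

lemma norm_slice_map:
  assumes "v \<in> quat_sphere"
  shows "norm (slice_map v z) = cmod z"
proof -
  have "(Im_i v)\<^sup>2 + (Im_j v)\<^sup>2 + (Im_k v)\<^sup>2 = 1"
    using quat_norm_square[of v] assms by (simp add: sphere_norm sphere_Re)
  moreover have "(norm (slice_map v z))\<^sup>2 =
      (Re z)\<^sup>2 + (Im z)\<^sup>2 * ((Im_i v)\<^sup>2 + (Im_j v)\<^sup>2 + (Im_k v)\<^sup>2)"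
    using assms unfolding quat_norm_square
    by (simp add: slice_map_scaleR sphere_Re power_mult_distrib distrib_left)
  ultimately have "(norm (slice_map v z))\<^sup>2 = (cmod z)\<^sup>2"
    by (simp add: cmod_power2)
  then show ?thesis by (simp add: power2_eq_iff_nonneg)
qed

lemma slice_map_uminus: "slice_map (- v) z = slice_map v (cnj z)"
  by (simp add: slice_map_scaleR)

lemma slice_map_i_mult:
  assumes "v \<in> quat_sphere"
  shows "slice_map v (\<i> * z) = v * slice_map v z"
  using sphere_square[OF assms] by (simp add: slice_map_scaleR of_real_def algebra_simps)

lemma sphere_mult_mult:
  assumes "v \<in> quat_sphere"
  shows "v * (v * x) = - x"
  using sphere_square[OF assms] by (simp flip: mult.assoc)

lemma slice_map_circularization:
  "v \<in> quat_sphere \<Longrightarrow> z \<in> \<U> \<Longrightarrow> slice_map v z \<in> circularization \<U>"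
  unfolding circularization_def by blast

lemma circularization_cases:
  assumes "q \<in> circularization \<U>"
  obtains v z where "v \<in> quat_sphere" "z \<in> \<U>" "q = slice_map v z"
  using assms unfolding circularization_def by blast

text \<open>
  The ambiguity in polar coordinates \<open>(v, z)\<close> on the quaternions: away from the real axis only
  \<open>(v, z) \<mapsto> (- v, cnj z)\<close>, on the real axis a free choice of \<open>v\<close>. Comparing norms of the imaginary parts
  fixes \<open>Im z\<close> up to sign.
\<close>

lemma slice_map_eq_cases:
  assumes "slice_map u z = slice_map v w" "u \<in> quat_sphere" "v \<in> quat_sphere"
  shows "(u = v \<and> z = w) \<or> (u = - v \<and> z = cnj w) \<or> (z = w \<and> cnj w = w)"
proof -
  have re: "Re z = Re w"
    using arg_cong[OF assms(1), of Re_q] assms(2,3) by (simp add: slice_map_scaleR sphere_Re)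
  then have im: "Im z *\<^sub>R u = Im w *\<^sub>R v"
    using assms(1) by (simp add: slice_map_scaleR)
  then have "norm (Im z *\<^sub>R u) = norm (Im w *\<^sub>R v)" by simp
  then have "\<bar>Im z\<bar> = \<bar>Im w\<bar>" using assms(2,3) by (simp add: sphere_norm)
  then consider "Im w = 0" "Im z = 0" | "Im w \<noteq> 0" "Im z = Im w" | "Im w \<noteq> 0" "Im z = - Im w"
    by (auto simp: abs_if split: if_splits)
  then show ?thesis
  proof cases
    case 3
    have "Im w *\<^sub>R u = Im w *\<^sub>R (- v)" using arg_cong[OF im, of uminus] 3 by simp
    with 3 have "u = - v" by (simp only: scaleR_cancel_left) simp
    with re 3 show ?thesis by (simp add: complex_eq_iff)
  qed (use re im in \<open>auto simp: complex_eq_iff\<close>)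
qed

lemma slice_regular_cong:
  assumes "slice_regular \<U> f" "\<And>q. q \<in> circularization \<U> \<Longrightarrow> f q = g q"
  shows "slice_regular \<U> g"
proof -
  have "f (slice_map v z) = g (slice_map v z)" if "z \<in> \<U>" "v \<in> quat_sphere" for v z
    using assms(2) slice_map_circularization that by blast
  then show ?thesis using assms(1) unfolding slice_regular_def by auto
qed

section \<open>The slice-regular extension\<close>

text \<open>
  The components \<open>\<alpha>\<close> and \<open>\<beta>\<close> of the slice function \<open>\<alpha> + u \<beta>\<close> that agrees on the slice of \<open>v\<close> with
  \<open>h\<close> transported by \<^term>\<open>slice_map v\<close>.
\<close>

definition stem_even :: "quat \<Rightarrow> (complex \<Rightarrow> complex) \<Rightarrow> complex \<Rightarrow> quat" where
  "stem_even v h z = (1/2) *\<^sub>R (slice_map v (h z) + slice_map v (h (cnj z)))"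

definition stem_odd :: "quat \<Rightarrow> (complex \<Rightarrow> complex) \<Rightarrow> complex \<Rightarrow> quat" where
  "stem_odd v h z = (1/2) *\<^sub>R (v * (slice_map v (h (cnj z)) - slice_map v (h z)))"

lemma stem_parity:
  "stem_even v h (cnj z) = stem_even v h z" "stem_odd v h (cnj z) = - stem_odd v h z"
  by (simp_all add: stem_even_def stem_odd_def algebra_simps)

text \<open>
  A pair with the parity of a stem takes the same value at both representations \<open>(v, z)\<close> and
  \<open>(- v, cnj z)\<close> of a point, and its odd component vanishes on the real axis, where \<open>v\<close> is arbitrary.
\<close>

lemma slice_function_exists:
  fixes \<alpha> \<beta> :: "complex \<Rightarrow> quat"
  assumes "\<And>z. \<alpha> (cnj z) = \<alpha> z" "\<And>z. \<beta> (cnj z) = - \<beta> z"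
  obtains f where "\<And>z v. v \<in> quat_sphere \<Longrightarrow> f (slice_map v z) = \<alpha> z + v * \<beta> z"
proof -
  define f where "f q = (THE p. \<exists>v z. v \<in> quat_sphere \<and> q = slice_map v z \<and> p = \<alpha> z + v * \<beta> z)" for q
  have real: "\<beta> z = 0" if "cnj z = z" for z
  proof -
    have "\<beta> z = - \<beta> z" using assms(2)[of z] that by simp
    then have "2 *\<^sub>R \<beta> z = 0" by (simp add: scaleR_2 eq_neg_iff_add_eq_0)
    then show ?thesis by simp
  qed
  have "f (slice_map v z) = \<alpha> z + v * \<beta> z" if v: "v \<in> quat_sphere" for v z
    unfolding f_def
  proof (rule the_equality)
    show "\<exists>v' z'. v' \<in> quat_sphere \<and> slice_map v z = slice_map v' z' \<and>
        \<alpha> z + v * \<beta> z = \<alpha> z' + v' * \<beta> z'"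
      using v by blast
    fix p assume "\<exists>v' z'. v' \<in> quat_sphere \<and> slice_map v z = slice_map v' z' \<and> p = \<alpha> z' + v' * \<beta> z'"
    then obtain v' z' where *: "v' \<in> quat_sphere" "slice_map v z = slice_map v' z'"
      and p: "p = \<alpha> z' + v' * \<beta> z'" by blast
    from slice_map_eq_cases[OF *(2) v *(1)] show "p = \<alpha> z + v * \<beta> z"
      unfolding p using assms real by auto
  qed
  then show ?thesis using that by blast
qed

text \<open>
  Put \<open>A = slice_map v (h' z)\<close> and \<open>B = slice_map v (h' (cnj z))\<close>. Since multiplication by \<open>\<i>\<close> becomes left
  multiplication by \<open>v\<close>, the \<open>x\<close>-derivatives of \<open>\<alpha>\<close> and \<open>\<beta>\<close> are \<open>(A + B)/2\<close> and \<open>v (B - A)/2\<close>, and the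
  \<open>y\<close>-derivatives are \<open>v (A - B)/2\<close> and \<open>(A + B)/2\<close>, the latter by \<open>v\<^sup>2 = - 1\<close>. These are the
  Cauchy-Riemann equations.
\<close>

lemma slice_regular_extension_exists:
  assumes \<U>: "open \<U>" "\<forall>z\<in>\<U>. cnj z \<in> \<U>" and h: "h holomorphic_on \<U>" and v: "v \<in> quat_sphere"
  obtains f where "slice_regular \<U> f"
    "\<And>z u. u \<in> quat_sphere \<Longrightarrow> f (slice_map u z) = stem_even v h z + u * stem_odd v h z"
proof -
  obtain f where f: "\<And>z u. u \<in> quat_sphere \<Longrightarrow>
      f (slice_map u z) = stem_even v h z + u * stem_odd v h z"
    using slice_function_exists[of "stem_even v h" "stem_odd v h"] stem_parity by metis
  have deriv: "(stem_even v h has_derivative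
        (\<lambda>t. (1/2) *\<^sub>R (slice_map v (deriv h z * t) + slice_map v (deriv h (cnj z) * cnj t)))) (at z)"
      "(stem_odd v h has_derivative
        (\<lambda>t. (1/2) *\<^sub>R (v * (slice_map v (deriv h (cnj z) * cnj t) - slice_map v (deriv h z * t))))) (at z)"
    if z: "z \<in> \<U>" for z
  proof -
    have hd: "(h has_derivative (\<lambda>t. deriv h x * t)) (at x)" if "x \<in> \<U>" for x
      using holomorphic_derivI[OF h \<U>(1) that] by (simp add: has_field_derivative_def)
    have 1: "((\<lambda>x. slice_map v (h x)) has_derivative (\<lambda>t. slice_map v (deriv h z * t))) (at z)"
      by (rule bounded_linear.has_derivative[OF bounded_linear_slice_map hd[OF z]])
    have "((\<lambda>x. h (cnj x)) has_derivative (\<lambda>t. deriv h (cnj z) * cnj t)) (at z)"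
      using has_derivative_compose[OF bounded_linear.has_derivative[OF bounded_linear_cnj
            has_derivative_ident] hd[of "cnj z"]] z \<U>(2) by simp
    then have 2: "((\<lambda>x. slice_map v (h (cnj x))) has_derivative
        (\<lambda>t. slice_map v (deriv h (cnj z) * cnj t))) (at z)"
      by (rule bounded_linear.has_derivative[OF bounded_linear_slice_map])
    show "(stem_even v h has_derivative
        (\<lambda>t. (1/2) *\<^sub>R (slice_map v (deriv h z * t) + slice_map v (deriv h (cnj z) * cnj t)))) (at z)"
      unfolding stem_even_def[abs_def] by (intro derivative_intros 1 2)
    show "(stem_odd v h has_derivative
        (\<lambda>t. (1/2) *\<^sub>R (v * (slice_map v (deriv h (cnj z) * cnj t) - slice_map v (deriv h z * t))))) (at z)"
      unfolding stem_odd_def[abs_def] by (intro derivative_intros 1 2)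
  qed
  have "slice_regular \<U> f"
    unfolding slice_regular_def
  proof (intro exI conjI ballI)
    fix z assume z: "z \<in> \<U>"
    note d = deriv[OF z]
    note D = frechet_derivative_at[OF d(1), symmetric] frechet_derivative_at[OF d(2), symmetric]
    show "stem_even v h differentiable at z" "stem_odd v h differentiable at z"
      using d by (auto simp: differentiable_def)
    show "stem_even v h (cnj z) = stem_even v h z" "stem_odd v h (cnj z) = - stem_odd v h z"
      by (rule stem_parity)+
    have i: "slice_map v (a * \<i>) = v * slice_map v a" "slice_map v (a * (- \<i>)) = - (v * slice_map v a)" for a
      using slice_map_i_mult[OF v, of a] linear_neg[OF bounded_linear.linear[OF bounded_linear_slice_map]]
      by (simp_all add: mult.commute)
    note vv = sphere_mult_mult[OF v]
    show "frechet_derivative (stem_even v h) (at z) 1 = frechet_derivative (stem_odd v h) (at z) \<i>"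
      "frechet_derivative (stem_even v h) (at z) \<i> = - frechet_derivative (stem_odd v h) (at z) 1"
      unfolding D complex_cnj_i complex_cnj_one i by (simp_all add: right_diff_distrib vv algebra_simps)
  qed (use f in auto)
  then show ?thesis using f that by blast
qed

text \<open>
  The measure on a slice is carried by the Borel sets of the slice, so measurability of the integrands has
  to be known there; it comes from continuity, because \<^term>\<open>slice_map v\<close> has a linear left inverse.
\<close>

lemma slice_regular_continuous_on_slice:
  assumes \<U>: "open \<U>" "\<forall>z\<in>\<U>. cnj z \<in> \<U>" and f: "slice_regular \<U> f" and v: "v \<in> quat_sphere"
  shows "continuous_on (circularization \<U> \<inter> slice_plane v) f"
proof -
  obtain \<alpha> \<beta> where ab: "\<And>z. z \<in> \<U> \<Longrightarrow> \<alpha> differentiable (at z) \<and> \<beta> differentiable (at z)"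
    and f: "\<And>z v. z \<in> \<U> \<Longrightarrow> v \<in> quat_sphere \<Longrightarrow> f (slice_map v z) = \<alpha> z + v * \<beta> z"
    using f unfolding slice_regular_def by blast
  \<comment> \<open>As \<open>v\<^sup>2 = - 1\<close>, multiplying \<open>x + v y\<close> by \<open>- v\<close> moves \<open>y\<close> into the real part.\<close>
  define inv where "inv s = Complex (Re_q s) (Re_q (s * (- v)))" for s
  have inv: "inv (slice_map v z) = z" for z
  proof -
    have "slice_map v z * v = Re z *\<^sub>R v - Im z *\<^sub>R 1"
      by (simp add: slice_map_scaleR distrib_right of_real_def sphere_square[OF v])
    then show ?thesis by (simp add: inv_def slice_map_scaleR sphere_Re[OF v] complex_eq_iff)
  qed
  have S: "inv s \<in> \<U> \<and> s = slice_map v (inv s)" if s: "s \<in> circularization \<U> \<inter> slice_plane v" for s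
  proof -
    obtain u w where w: "u \<in> quat_sphere" "w \<in> \<U>" "s = slice_map u w"
      using IntD1[OF s] by (rule circularization_cases)
    obtain x y where "s = of_real x + v * of_real y"
      using s unfolding slice_plane_def by blast
    then have xy: "s = slice_map v (Complex x y)" by (simp add: slice_map_def)
    with w slice_map_eq_cases[of v "Complex x y" u w] v \<U>(2) have "Complex x y \<in> \<U>" by auto
    with xy inv show ?thesis by simp
  qed
  have "linear inv"
    by (simp add: linear_iff inv_def complex_eq_iff algebra_simps)
  then have "continuous_on A inv" for A
    by (rule linear_continuous_on[OF linear_conv_bounded_linear[THEN iffD1]])
  moreover have "continuous_on \<U> (\<lambda>z. \<alpha> z + v * \<beta> z)"
    using ab by (intro continuous_intros differentiable_imp_continuous_on)
      (auto simp: differentiable_on_def intro: differentiable_at_withinI)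
  ultimately have "continuous_on (circularization \<U> \<inter> slice_plane v) (\<lambda>s. \<alpha> (inv s) + v * \<beta> (inv s))"
    using S by (intro continuous_on_compose2[of \<U> "\<lambda>z. \<alpha> z + v * \<beta> z" _ inv]) auto
  moreover have "\<alpha> (inv s) + v * \<beta> (inv s) = f s" if "s \<in> circularization \<U> \<inter> slice_plane v" for s
    using S[OF that] f[of "inv s" v] v by simp
  ultimately show ?thesis
    by (rule continuous_on_eq)
qed

section \<open>Symmetries of the Bergman kernel\<close>

lemma bergman_kernel_reproduces:
  assumes "is_bergman_kernel \<U> K" "z \<in> \<U>" "h \<in> bergman_space \<U>"
  shows "h z = (\<integral>w. K z w * h w \<partial>lebesgue_on \<U>)"
  using assms unfolding is_bergman_kernel_def by blast

lemma bergman_kernel_section: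
  assumes "is_bergman_kernel \<U> K" "z \<in> \<U>"
  shows "(\<lambda>w. cnj (K z w)) \<in> bergman_space \<U>"
  using assms unfolding is_bergman_kernel_def by blast

text \<open>
  Apply the reproducing property of \<open>K\<close> at \<open>w\<close> to the section of \<open>L\<close> at \<open>z\<close>, and that of \<open>L\<close> at \<open>z\<close> to the
  section of \<open>K\<close> at \<open>w\<close>: the two integrals are complex conjugates of each other. This one identity
  contains both the uniqueness of the kernel and its Hermitian symmetry.
\<close>

lemma bergman_kernels_adjoint:
  assumes K: "is_bergman_kernel \<U> K" and L: "is_bergman_kernel \<U> L" and z: "z \<in> \<U>" and w: "w \<in> \<U>"
  shows "L z w = cnj (K w z)"
proof -
  have "cnj (L z w) = (\<integral>x. K w x * cnj (L z x) \<partial>lebesgue_on \<U>)"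
    using bergman_kernel_reproduces[OF K w bergman_kernel_section[OF L z]] .
  moreover have "cnj (K w z) = (\<integral>x. L z x * cnj (K w x) \<partial>lebesgue_on \<U>)"
    using bergman_kernel_reproduces[OF L z bergman_kernel_section[OF K w]] .
  then have "K w z = cnj (\<integral>x. L z x * cnj (K w x) \<partial>lebesgue_on \<U>)"
    by (metis complex_cnj_cnj)
  then have "K w z = (\<integral>x. K w x * cnj (L z x) \<partial>lebesgue_on \<U>)"
    by (simp add: Bochner_Integration.integral_cnj[symmetric] mult.commute del: Bochner_Integration.integral_cnj)
  ultimately show ?thesis by (metis complex_cnj_cnj)
qed

text \<open>
  Conjugation is the diagonal map with entries \<open>1\<close> and \<open>- 1\<close> in the standard basis, whose determinant
  has modulus one.
\<close>

lemma distr_lebesgue_on_cnj: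
  assumes "open \<U>" "\<forall>z\<in>\<U>. cnj z \<in> \<U>"
  shows "cnj \<in> lebesgue_on \<U> \<rightarrow>\<^sub>M lebesgue_on \<U>"
    and "distr (lebesgue_on \<U>) (lebesgue_on \<U>) cnj = lebesgue_on \<U>"
proof -
  define c :: "complex \<Rightarrow> real" where "c b = (if b = \<i> then - 1 else 1)" for b
  have T: "(\<lambda>x. 0 + (\<Sum>j\<in>Basis. (c j * (x \<bullet> j)) *\<^sub>R j)) = cnj"
    by (auto simp: fun_eq_iff Basis_complex_def c_def complex_eq_iff)
  have c: "c j \<noteq> 0" for j by (simp add: c_def)
  have m: "cnj \<in> lebesgue \<rightarrow>\<^sub>M lebesgue"
    using lebesgue_affine_measurable[of c 0] c unfolding T by simp
  have "(\<Prod>j\<in>Basis. \<bar>c j\<bar>) = 1" by (intro prod.neutral) (simp add: c_def)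
  with lebesgue_affine_euclidean[of c 0] c have d: "lebesgue = distr lebesgue lebesgue cnj"
    unfolding T by (simp add: density_1)
  show mU: "cnj \<in> lebesgue_on \<U> \<rightarrow>\<^sub>M lebesgue_on \<U>"
    using assms(2) by (intro measurable_restrict_space3 m) auto
  have U: "\<U> \<in> sets lebesgue" using assms(1) by (simp add: borel_open)
  show "distr (lebesgue_on \<U>) (lebesgue_on \<U>) cnj = lebesgue_on \<U>"
  proof (rule measure_eqI)
    fix A assume "A \<in> sets (distr (lebesgue_on \<U>) (lebesgue_on \<U>) cnj)"
    then have A: "A \<in> sets (lebesgue_on \<U>)" by simp
    then have AU: "A \<subseteq> \<U>" "A \<in> sets lebesgue"
      using U by (auto simp: sets_restrict_space_iff)
    then have "cnj -` A \<subseteq> \<U>" using assms(2) by (metis complex_cnj_cnj subsetD subsetI vimageD)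
    then have "emeasure (distr (lebesgue_on \<U>) (lebesgue_on \<U>) cnj) A = emeasure (lebesgue_on \<U>) (cnj -` A)"
      using A mU by (simp add: emeasure_distr inf_absorb1)
    also have "\<dots> = emeasure lebesgue (cnj -` A)"
      using U \<open>cnj -` A \<subseteq> \<U>\<close> by (simp add: emeasure_restrict_space)
    also have "\<dots> = emeasure (distr lebesgue lebesgue cnj) A"
      using m AU by (simp add: emeasure_distr)
    also have "\<dots> = emeasure (lebesgue_on \<U>) A"
      using U AU by (simp add: emeasure_restrict_space d[symmetric])
    finally show "emeasure (distr (lebesgue_on \<U>) (lebesgue_on \<U>) cnj) A = emeasure (lebesgue_on \<U>) A" .
  qed simp
qed

lemma bergman_space_measurable:
  assumes "open \<U>" "h \<in> bergman_space \<U>"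
  shows "h \<in> borel_measurable (lebesgue_on \<U>)"
  using assms
  by (intro continuous_imp_measurable_on_sets_lebesgue)
    (auto simp: bergman_space_def borel_open holomorphic_on_imp_continuous_on)

lemma bergman_kernel_measurable:
  assumes "open \<U>" "is_bergman_kernel \<U> K" "z \<in> \<U>"
  shows "K z \<in> borel_measurable (lebesgue_on \<U>)"
proof -
  have "(\<lambda>w. cnj (cnj (K z w))) \<in> borel_measurable (lebesgue_on \<U>)"
    by (rule measurable_compose[OF bergman_space_measurable[OF assms(1) bergman_kernel_section[OF assms(2,3)]]
          borel_measurable_continuous_onI[OF linear_continuous_on[OF bounded_linear_cnj]]])
  then show ?thesis by simp
qed

lemma holomorphic_on_cnj_cnj:
  assumes "open \<U>" "\<forall>z\<in>\<U>. cnj z \<in> \<U>" "h holomorphic_on \<U>"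
  shows "(\<lambda>z. cnj (h (cnj z))) holomorphic_on \<U>"
proof -
  have "cnj ` \<U> = \<U>" using assms(2) by (metis complex_cnj_cnj image_eqI image_subsetI subsetI subset_antisym)
  then show ?thesis
    using assms holomorphic_on_compose_cnj_cnj[of h \<U>] by (simp add: o_def)
qed

lemma bergman_space_cnj:
  assumes "open \<U>" "\<forall>z\<in>\<U>. cnj z \<in> \<U>" "h \<in> bergman_space \<U>"
  shows "(\<lambda>z. cnj (h (cnj z))) \<in> bergman_space \<U>"
proof -
  note [measurable] = bergman_space_measurable[OF assms(1,3)]
  have "integrable (distr (lebesgue_on \<U>) (lebesgue_on \<U>) cnj) (\<lambda>z. (cmod (h z))\<^sup>2)"
    using assms(3) by (simp add: bergman_space_def distr_lebesgue_on_cnj[OF assms(1,2)])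
  then have "integrable (lebesgue_on \<U>) (\<lambda>z. (cmod (h (cnj z)))\<^sup>2)"
    by (subst (asm) integrable_distr_eq) (auto intro: distr_lebesgue_on_cnj[OF assms(1,2)])
  then show ?thesis
    using assms holomorphic_on_cnj_cnj by (auto simp: bergman_space_def)
qed

text \<open>
  The involution \<open>h \<mapsto> cnj \<circ> h \<circ> cnj\<close> maps the Bergman space to itself; reproducing the image of \<open>h\<close> and
  substituting \<open>cnj w\<close> for \<open>w\<close> in the integral transports the kernel.
\<close>

lemma bergman_kernel_cnj:
  assumes \<U>: "open \<U>" "\<forall>z\<in>\<U>. cnj z \<in> \<U>" and K: "is_bergman_kernel \<U> K"
  shows "is_bergman_kernel \<U> (\<lambda>z w. cnj (K (cnj z) (cnj w)))"
  unfolding is_bergman_kernel_def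
proof (intro ballI conjI)
  fix z assume "z \<in> \<U>"
  then have z: "cnj z \<in> \<U>" using \<U>(2) by blast
  show "(\<lambda>w. cnj (cnj (K (cnj z) (cnj w)))) \<in> bergman_space \<U>"
    using bergman_space_cnj[OF \<U>, of "\<lambda>w. cnj (K (cnj z) w)"] K z
    unfolding is_bergman_kernel_def by simp
  fix h assume h: "h \<in> bergman_space \<U>"
  have h': "(\<lambda>z. cnj (h (cnj z))) \<in> bergman_space \<U>" by (rule bergman_space_cnj[OF \<U> h])
  note [measurable] = bergman_kernel_measurable[OF \<U>(1) K z] bergman_space_measurable[OF \<U>(1) h']
  have "cnj (h z) = (\<integral>w. K (cnj z) w * cnj (h (cnj w)) \<partial>lebesgue_on \<U>)"
    using bergman_kernel_reproduces[OF K z h'] by simp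
  also have "\<dots> = (\<integral>w. K (cnj z) w * cnj (h (cnj w))
      \<partial>distr (lebesgue_on \<U>) (lebesgue_on \<U>) cnj)"
    by (simp add: distr_lebesgue_on_cnj[OF \<U>])
  also have "\<dots> = (\<integral>w. K (cnj z) (cnj w) * cnj (h w) \<partial>lebesgue_on \<U>)"
    by (subst integral_distr) (auto intro: distr_lebesgue_on_cnj[OF \<U>])
  finally have "h z = cnj \<dots>" by (metis complex_cnj_cnj)
  then show "h z = (\<integral>w. cnj (K (cnj z) (cnj w)) * h w \<partial>lebesgue_on \<U>)"
    by (simp add: Bochner_Integration.integral_cnj[symmetric] del: Bochner_Integration.integral_cnj)
qed

lemma bergman_kernel_hermitian:
  assumes "is_bergman_kernel \<U> K" "z \<in> \<U>" "w \<in> \<U>"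
  shows "K z w = cnj (K w z)"
  using bergman_kernels_adjoint[OF assms(1,1,2,3)] .

lemma bergman_kernel_reflect:
  assumes "open \<U>" "\<forall>z\<in>\<U>. cnj z \<in> \<U>" "is_bergman_kernel \<U> K" "z \<in> \<U>" "w \<in> \<U>"
  shows "K (cnj z) (cnj w) = cnj (K z w)"
  using bergman_kernels_adjoint[OF assms(3) bergman_kernel_cnj[OF assms(1-3)] assms(4,5)]
    bergman_kernel_hermitian[OF assms(3,4,5)] by (metis complex_cnj_cnj)

lemma bergman_kernel_holomorphic:
  assumes "is_bergman_kernel \<U> K" "w \<in> \<U>"
  shows "(\<lambda>z. K z w) holomorphic_on \<U>"
proof -
  have "(\<lambda>z. cnj (K w z)) holomorphic_on \<U>"
    using bergman_kernel_section[OF assms] by (simp add: bergman_space_def)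
  then show ?thesis
    by (rule holomorphic_transform) (metis assms bergman_kernel_hermitian)
qed

section \<open>The slice-regular Bergman kernel\<close>

text \<open>
  The value at \<^term>\<open>slice_map u z\<close> of the slice-regular extension in the first variable, with the second
  variable given through a representation \<^term>\<open>slice_map v w\<close>.
\<close>

definition slice_kernel ::
    "(complex \<Rightarrow> complex \<Rightarrow> complex) \<Rightarrow> quat \<Rightarrow> complex \<Rightarrow> quat \<Rightarrow> complex \<Rightarrow> quat" where
  "slice_kernel K u z v w = stem_even v (\<lambda>x. K x w) z + u * stem_odd v (\<lambda>x. K x w) z"

text \<open>
  Real coefficients commute with the units, so this form displays the effect of exchanging the two
  variables: the reversal of \<open>u v\<close> is undone by quaternionic conjugation.
\<close>

lemma slice_kernel_expand:
  assumes v: "v \<in> quat_sphere"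
  shows "slice_kernel K u z v w = (1/2) *\<^sub>R
     (of_real (Re (K z w) + Re (K (cnj z) w)) + (Im (K z w) + Im (K (cnj z) w)) *\<^sub>R v +
      (Im (K z w) - Im (K (cnj z) w)) *\<^sub>R u + (Re (K (cnj z) w) - Re (K z w)) *\<^sub>R (u * v))"
  using sphere_square[OF v]
  by (simp add: slice_kernel_def stem_even_def stem_odd_def slice_map_scaleR of_real_def algebra_simps)

text \<open>
  Exchanging \<open>z\<close> and \<open>w\<close> conjugates \<open>K(z,w)\<close> but leaves \<open>K(cnj z, w)\<close> fixed, since
  \<open>K(cnj w, z) = cnj (K(z, cnj w)) = K(cnj z, w)\<close>. In the expansion, the coefficients of \<open>1\<close> and of the product
  are preserved, while those of \<open>u\<close> and \<open>v\<close> change sign.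
\<close>

lemma slice_kernel_hermitian:
  assumes \<U>: "open \<U>" "\<forall>z\<in>\<U>. cnj z \<in> \<U>" and K: "is_bergman_kernel \<U> K"
    and uv: "u \<in> quat_sphere" "v \<in> quat_sphere" and zw: "z \<in> \<U>" "w \<in> \<U>"
  shows "slice_kernel K u z v w = qcnj (slice_kernel K v w u z)"
proof -
  have "K w z = cnj (K z w)"
    using bergman_kernel_hermitian[OF K zw(2,1)] .
  moreover have "K (cnj w) z = K (cnj z) w"
  proof -
    have "K (cnj w) z = cnj (K z (cnj w))"
      using bergman_kernel_hermitian[OF K _ zw(1)] \<U>(2) zw by blast
    also have "\<dots> = K (cnj z) (cnj (cnj w))"
      using bergman_kernel_reflect[OF \<U> K zw(1)] \<U>(2) zw(2) by metis
    finally show ?thesis by simp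
  qed
  ultimately show ?thesis
    unfolding slice_kernel_expand[OF uv(1)] slice_kernel_expand[OF uv(2)]
    by (simp add: qcnj_mult qcnj_sphere uv algebra_simps)
qed

lemma stem_recover:
  assumes v: "v \<in> quat_sphere"
  shows "stem_even v h z + v * stem_odd v h z = slice_map v (h z)"
proof -
  have "stem_even v h z + v * stem_odd v h z = (1/2) *\<^sub>R (slice_map v (h z) + slice_map v (h z))"
    by (simp add: stem_even_def stem_odd_def sphere_mult_mult[OF v] flip: scaleR_add_right scaleR_diff_right)
  then show ?thesis by (simp only: scaleR_half_double)
qed

text \<open>
  Independence of the representation of the second variable. For \<open>(- v, cnj w)\<close> it is the reflection
  symmetry of \<open>K\<close>; for real \<open>w\<close> the symmetry says that the even part of \<open>K(\<cdot>,w)\<close> is real and the odd part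
  imaginary, so that no trace of \<open>v\<close> remains.
\<close>

lemma slice_kernel_on_slice:
  assumes \<U>: "open \<U>" "\<forall>z\<in>\<U>. cnj z \<in> \<U>" and K: "is_bergman_kernel \<U> K"
    and uv: "u \<in> quat_sphere" "v \<in> quat_sphere" and zw: "z \<in> \<U>" "w \<in> \<U>"
    and eq: "slice_map u w' = slice_map v w"
  shows "slice_kernel K u z v w = slice_map u (K z w')"
proof -
  have reflect: "K (cnj z) w = cnj (K z (cnj w))"
    using bergman_kernel_reflect[OF \<U> K zw(1), of "cnj w"] \<U>(2) zw by simp
  show ?thesis
    using slice_map_eq_cases[OF eq uv]
  proof (elim disjE conjE)
    assume "u = v" "w' = w"
    then show ?thesis
      using stem_recover[OF uv(2)] by (simp add: slice_kernel_def)
  next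
    assume *: "u = - v" "w' = cnj w"
    then have "slice_kernel K u z v w = stem_even v (\<lambda>x. K x w) (cnj z) + v * stem_odd v (\<lambda>x. K x w) (cnj z)"
      by (simp add: slice_kernel_def stem_parity)
    then show ?thesis
      using stem_recover[OF uv(2)] by (simp add: * reflect slice_map_uminus)
  next
    assume *: "w' = w" "cnj w = w"
    then have "K (cnj z) w = cnj (K z w)" using reflect by simp
    then have "slice_kernel K u z v w = of_real (Re (K z w)) + Im (K z w) *\<^sub>R u"
      unfolding slice_kernel_expand[OF uv(2)] by (simp add: of_real_def scaleR_add_right)
    then show ?thesis by (simp add: * slice_map_scaleR)
  qed
qed

lemma slice_extension_kernel:
  assumes \<U>: "open \<U>" "\<forall>z\<in>\<U>. cnj z \<in> \<U>" and K: "is_bergman_kernel \<U> K"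
    and s: "s \<in> circularization \<U>"
  shows "slice_regular \<U> (\<lambda>q. slice_extension \<U> K q s)"
    and "\<And>u z v w. u \<in> quat_sphere \<Longrightarrow> z \<in> \<U> \<Longrightarrow> v \<in> quat_sphere \<Longrightarrow> w \<in> \<U> \<Longrightarrow> s = slice_map v w \<Longrightarrow>
      slice_extension \<U> K (slice_map u z) s = slice_kernel K u z v w"
proof -
  have *: "\<exists>f. is_slice_extension \<U> K s f \<and>
      (\<forall>u\<in>quat_sphere. \<forall>z\<in>\<U>. f (slice_map u z) = slice_kernel K u z v w)"
    if v: "v \<in> quat_sphere" and w: "w \<in> \<U>" and s: "s = slice_map v w" for v w
  proof -
    obtain f where reg: "slice_regular \<U> f"
      and f: "\<And>z u. u \<in> quat_sphere \<Longrightarrow> f (slice_map u z) = slice_kernel K u z v w"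
      using slice_regular_extension_exists[OF \<U> bergman_kernel_holomorphic[OF K w] v]
      unfolding slice_kernel_def by metis
    have "is_slice_extension \<U> K s f"
      unfolding is_slice_extension_def
      using reg f slice_kernel_on_slice[OF \<U> K _ v _ w] s by metis
    with f show ?thesis by blast
  qed
  show eq: "slice_extension \<U> K (slice_map u z) s = slice_kernel K u z v w"
    if "u \<in> quat_sphere" "z \<in> \<U>" "v \<in> quat_sphere" "w \<in> \<U>" "s = slice_map v w" for u z v w
    using *[OF that(3-5)] slice_extension_eq[OF \<U>(2) _ s slice_map_circularization[OF that(1,2)]] that
    by metis
  obtain v w where "v \<in> quat_sphere" "w \<in> \<U>" "s = slice_map v w"
    using s by (rule circularization_cases)
  then obtain f where "is_slice_extension \<U> K s f" using * by blast
  then show "slice_regular \<U> (\<lambda>q. slice_extension \<U> K q s)"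
    using slice_regular_cong[of \<U> f] slice_extension_eq[OF \<U>(2) _ s]
    unfolding is_slice_extension_def by metis
qed

lemma slice_extension_hermitian:
  assumes \<U>: "open \<U>" "\<forall>z\<in>\<U>. cnj z \<in> \<U>" and K: "is_bergman_kernel \<U> K"
    and q: "q \<in> circularization \<U>" and s: "s \<in> circularization \<U>"
  shows "slice_extension \<U> K q s = qcnj (slice_extension \<U> K s q)"
proof -
  obtain u z where z: "u \<in> quat_sphere" "z \<in> \<U>" "q = slice_map u z"
    using q by (rule circularization_cases)
  obtain v w where w: "v \<in> quat_sphere" "w \<in> \<U>" "s = slice_map v w"
    using s by (rule circularization_cases)
  show ?thesis
    using slice_extension_kernel(2)[OF \<U> K s z(1,2) w] slice_extension_kernel(2)[OF \<U> K q w(1,2) z]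
      slice_kernel_hermitian[OF \<U> K z(1) w(1) z(2) w(2)] z w by metis
qed

lemma slice_extension_antiregular:
  assumes \<U>: "open \<U>" "\<forall>z\<in>\<U>. cnj z \<in> \<U>" and K: "is_bergman_kernel \<U> K"
    and q: "q \<in> circularization \<U>"
  shows "slice_antiregular \<U> (\<lambda>s. slice_extension \<U> K q s)"
  unfolding slice_antiregular_def
  by (rule slice_regular_cong[OF slice_extension_kernel(1)[OF \<U> K q]])
    (rule slice_extension_hermitian[OF \<U> K _ q])

section \<open>The reproducing property\<close>

text \<open>
  For the complex structure \<open>q \<mapsto> v q\<close>, this is the complex-linear functional whose real part is the inner
  product with \<open>c\<close>; \<open>slice_coord_mult\<close> is the linearity.
\<close>

definition slice_coord :: "quat \<Rightarrow> quat \<Rightarrow> quat \<Rightarrow> complex" where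
  "slice_coord v c q = Complex (q \<bullet> c) (q \<bullet> (v * c))"

lemma bounded_linear_slice_coord: "bounded_linear (slice_coord v c)"
  by (simp add: linear_conv_bounded_linear[symmetric] linear_iff slice_coord_def complex_eq_iff
      inner_add_left)

lemma inner_sphere_mult:
  "v \<in> quat_sphere \<Longrightarrow> (v * p) \<bullet> q = - (p \<bullet> (v * q))"
  by (simp add: inner_quat_def quat_sel_times sphere_Re algebra_simps)

lemma slice_coord_mult:
  assumes v: "v \<in> quat_sphere"
  shows "slice_coord v c (slice_map v k * q) = k * slice_coord v c q"
proof -
  have "(v * q) \<bullet> (v * c) = q \<bullet> c"
    using sphere_square[OF v] by (simp add: inner_sphere_mult[OF v] flip: mult.assoc)
  then show ?thesis
    by (simp add: slice_coord_def complex_eq_iff slice_map_scaleR of_real_def distrib_right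
        inner_add_left inner_sphere_mult[OF v])
qed

lemma slice_coord_bound:
  assumes v: "v \<in> quat_sphere"
  shows "(cmod (slice_coord v c q))\<^sup>2 \<le> (2 * (norm c)\<^sup>2) * (norm q)\<^sup>2"
proof -
  have "(q \<bullet> c)\<^sup>2 \<le> (norm q * norm c)\<^sup>2" "(q \<bullet> (v * c))\<^sup>2 \<le> (norm q * norm c)\<^sup>2"
    using Cauchy_Schwarz_ineq2[of q c] Cauchy_Schwarz_ineq2[of q "v * c"] sphere_norm[OF v]
    by (simp_all add: power2_le_iff_abs_le norm_mult)
  moreover have "(cmod (slice_coord v c q))\<^sup>2 = (q \<bullet> c)\<^sup>2 + (q \<bullet> (v * c))\<^sup>2"
    by (simp add: slice_coord_def cmod_power2)
  moreover have "(2 * (norm c)\<^sup>2) * (norm q)\<^sup>2 = 2 * (norm q * norm c)\<^sup>2"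
    by (simp add: power_mult_distrib)
  ultimately show ?thesis by linarith
qed

text \<open>
  The hypothesis \<open>D \<i> = v * D 1\<close> says that the derivative is complex linear for the complex structure
  \<open>q \<mapsto> v q\<close>, and a complex-linear functional preserves this.
\<close>

lemma slice_coord_holomorphic:
  assumes v: "v \<in> quat_sphere"
    and g: "\<And>z. z \<in> \<U> \<Longrightarrow> \<exists>D. (g has_derivative D) (at z) \<and> D \<i> = v * D 1"
  shows "(\<lambda>z. slice_coord v c (g z)) holomorphic_on \<U>"
proof (rule holomorphic_onI)
  fix z assume "z \<in> \<U>"
  with g obtain D where D: "(g has_derivative D) (at z)" "D \<i> = v * D 1" by blast
  have D_eq: "D t = slice_map v t * D 1" for t
  proof -
    interpret D: linear D using D(1) by (rule has_derivative_linear)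
    have "t = Re t *\<^sub>R 1 + Im t *\<^sub>R \<i>" by (simp add: complex_eq_iff)
    from arg_cong[OF this, of D] have "D t = Re t *\<^sub>R D 1 + Im t *\<^sub>R D \<i>"
      by (simp only: D.add D.scale)
    then show ?thesis by (simp add: D(2) slice_map_scaleR of_real_def distrib_right)
  qed
  have "slice_coord v c (D t) = slice_coord v c (D 1) * t" for t
    unfolding D_eq[of t] slice_coord_mult[OF v] by (rule mult.commute)
  then have "(\<lambda>t. slice_coord v c (D t)) = (*) (slice_coord v c (D 1))" by (rule ext)
  then have "((\<lambda>z. slice_coord v c (g z)) has_field_derivative slice_coord v c (D 1)) (at z)"
    using bounded_linear.has_derivative[OF bounded_linear_slice_coord[of v c] D(1)]
    by (simp add: has_field_derivative_def)
  then show "(\<lambda>z. slice_coord v c (g z)) field_differentiable at z within \<U>"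
    using field_differentiable_at_within field_differentiable_def by blast
qed

text \<open>
  Quaternion-valued functions on one slice are reproduced coordinatewise: the classical property holds
  for every \<^term>\<open>slice_coord v c\<close> of \<open>g\<close>, and its real part tests the integral against every vector \<open>c\<close>.
  Integrability of the product comes from \<open>2 a b \<le> a\<^sup>2 + b\<^sup>2\<close>.
\<close>

lemma slice_reproducing:
  assumes \<U>: "open \<U>" and K: "is_bergman_kernel \<U> K" and v: "v \<in> quat_sphere"
    and g: "\<And>z. z \<in> \<U> \<Longrightarrow> \<exists>D. (g has_derivative D) (at z) \<and> D \<i> = v * D 1"
    and int: "integrable (lebesgue_on \<U>) (\<lambda>w. (norm (g w))\<^sup>2)" and z: "z \<in> \<U>"
  shows "has_bochner_integral (lebesgue_on \<U>) (\<lambda>w. slice_map v (K z w) * g w) (g z)"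
proof -
  have "continuous_on \<U> g"
    using g by (intro continuous_at_imp_continuous_on ballI) (blast intro: has_derivative_continuous)
  then have [measurable]: "g \<in> borel_measurable (lebesgue_on \<U>)"
    using \<U> by (intro continuous_imp_measurable_on_sets_lebesgue) (auto simp: borel_open)
  note [measurable] = bergman_kernel_measurable[OF \<U> K z]
  have [measurable]: "slice_map v \<in> borel_measurable borel"
    by (intro borel_measurable_continuous_onI linear_continuous_on bounded_linear_slice_map)
  have I: "integrable (lebesgue_on \<U>) (\<lambda>w. slice_map v (K z w) * g w)"
  proof (rule Bochner_Integration.integrable_bound)
    show "integrable (lebesgue_on \<U>) (\<lambda>w. (cmod (cnj (K z w)))\<^sup>2 + (norm (g w))\<^sup>2)"
      using bergman_kernel_section[OF K z] int
      by (intro Bochner_Integration.integrable_add) (simp_all add: bergman_space_def)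
    have "norm (slice_map v (K z w) * g w) \<le> (cmod (cnj (K z w)))\<^sup>2 + (norm (g w))\<^sup>2" for w
    proof -
      have "0 \<le> cmod (K z w) * norm (g w)" by simp
      with sum_squares_bound[of "cmod (K z w)" "norm (g w)"] show ?thesis
        unfolding norm_mult norm_slice_map[OF v] complex_mod_cnj by linarith
    qed
    then show "AE w in lebesgue_on \<U>. norm (slice_map v (K z w) * g w)
        \<le> norm ((cmod (cnj (K z w)))\<^sup>2 + (norm (g w))\<^sup>2)"
      by (simp add: abs_of_nonneg)
  qed measurable
  moreover have "(\<integral>w. slice_map v (K z w) * g w \<partial>lebesgue_on \<U>) \<bullet> c = g z \<bullet> c" for c
  proof -
    have "(\<lambda>w. slice_coord v c (g w)) \<in> bergman_space \<U>"
      unfolding bergman_space_def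
    proof (intro CollectI conjI)
      show hol: "(\<lambda>w. slice_coord v c (g w)) holomorphic_on \<U>"
        by (rule slice_coord_holomorphic[OF v g])
      have [measurable]: "(\<lambda>w. slice_coord v c (g w)) \<in> borel_measurable (lebesgue_on \<U>)"
        using \<U> hol by (intro continuous_imp_measurable_on_sets_lebesgue)
          (auto simp: borel_open holomorphic_on_imp_continuous_on)
      show "integrable (lebesgue_on \<U>) (\<lambda>w. (cmod (slice_coord v c (g w)))\<^sup>2)"
      proof (rule Bochner_Integration.integrable_bound)
        show "integrable (lebesgue_on \<U>) (\<lambda>w. (2 * (norm c)\<^sup>2) * (norm (g w))\<^sup>2)"
          by (intro integrable_mult_right int)
        show "AE w in lebesgue_on \<U>. norm ((cmod (slice_coord v c (g w)))\<^sup>2)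
            \<le> norm ((2 * (norm c)\<^sup>2) * (norm (g w))\<^sup>2)"
          using slice_coord_bound[OF v] by (simp add: abs_of_nonneg)
      qed measurable
    qed
    from bergman_kernel_reproduces[OF K z this]
    have "slice_coord v c (g z) = (\<integral>w. slice_coord v c (slice_map v (K z w) * g w) \<partial>lebesgue_on \<U>)"
      by (simp add: slice_coord_mult[OF v])
    also have "\<dots> = slice_coord v c (\<integral>w. slice_map v (K z w) * g w \<partial>lebesgue_on \<U>)"
      by (rule integral_bounded_linear[OF bounded_linear_slice_coord I])
    finally show ?thesis by (simp add: slice_coord_def)
  qed
  then have "(\<integral>w. slice_map v (K z w) * g w \<partial>lebesgue_on \<U>) = g z"
    by (intro vector_eq_rdot[THEN iffD1]) blast
  ultimately show ?thesis by (simp add: has_bochner_integral_iff)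
qed

lemma slice_regular_derivative:
  assumes "slice_regular \<U> f" "open \<U>" "v \<in> quat_sphere" "z \<in> \<U>"
  shows "\<exists>D. ((\<lambda>w. f (slice_map v w)) has_derivative D) (at z) \<and> D \<i> = v * D 1"
proof -
  obtain \<alpha> \<beta> where d: "\<alpha> differentiable (at z)" "\<beta> differentiable (at z)"
    and CR: "frechet_derivative \<alpha> (at z) 1 = frechet_derivative \<beta> (at z) \<i>"
      "frechet_derivative \<alpha> (at z) \<i> = - frechet_derivative \<beta> (at z) 1"
    and f: "\<And>w. w \<in> \<U> \<Longrightarrow> f (slice_map v w) = \<alpha> w + v * \<beta> w"
    using assms unfolding slice_regular_def by blast
  let ?D = "\<lambda>t. frechet_derivative \<alpha> (at z) t + v * frechet_derivative \<beta> (at z) t"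
  have "((\<lambda>w. \<alpha> w + v * \<beta> w) has_derivative ?D) (at z)"
    using d by (intro derivative_intros) (simp_all add: frechet_derivative_works)
  then have "((\<lambda>w. f (slice_map v w)) has_derivative ?D) (at z)"
    by (rule has_derivative_transform_within_open[OF _ assms(2,4)]) (simp add: f)
  moreover have "?D \<i> = v * ?D 1"
    using sphere_square[OF assms(3)] by (simp add: CR distrib_left flip: mult.assoc)
  ultimately show ?thesis by blast
qed

text \<open>
  The coefficients here are those of \<open>slice_regular_representation\<close>. They stand to the left of the values
  on the slice of \<open>v\<close>, so they come out of the integral.
\<close>

lemma slice_kernel_combination:
  "slice_kernel K u z v w = ((1/2) *\<^sub>R (1 - u * v)) * slice_map v (K z w)
     + ((1/2) *\<^sub>R (1 + u * v)) * slice_map v (K (cnj z) w)"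
  by (simp add: slice_kernel_def stem_even_def stem_odd_def algebra_simps mult.assoc)

text \<open>
  With \<open>\<alpha> + v \<beta>\<close> and \<open>\<alpha> - v \<beta>\<close> as the two values on the slice of \<open>v\<close>, the products \<open>u v \<alpha>\<close> cancel and
  \<open>- u v v \<beta> = u \<beta>\<close>.
\<close>

lemma slice_regular_representation:
  assumes "slice_regular \<U> f" "\<forall>z\<in>\<U>. cnj z \<in> \<U>" "u \<in> quat_sphere" "v \<in> quat_sphere" "z \<in> \<U>"
  shows "f (slice_map u z) = ((1/2) *\<^sub>R (1 - u * v)) * f (slice_map v z)
     + ((1/2) *\<^sub>R (1 + u * v)) * f (slice_map v (cnj z))"
proof -
  obtain \<alpha> \<beta> where par: "\<alpha> (cnj z) = \<alpha> z" "\<beta> (cnj z) = - \<beta> z"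
    and f: "\<And>w v. w \<in> \<U> \<Longrightarrow> v \<in> quat_sphere \<Longrightarrow> f (slice_map v w) = \<alpha> w + v * \<beta> w"
    using assms unfolding slice_regular_def by blast
  have "f (slice_map v (cnj z)) = \<alpha> z - v * \<beta> z"
    using f[OF bspec[OF assms(2,5)] assms(4)] par by simp
  moreover have "(1 - u * v) * (\<alpha> z + v * \<beta> z) + (1 + u * v) * (\<alpha> z - v * \<beta> z) =
      (\<alpha> z + u * \<beta> z) + (\<alpha> z + u * \<beta> z)"
    by (simp add: distrib_left distrib_right left_diff_distrib right_diff_distrib mult.assoc
        sphere_mult_mult[OF assms(4)])
  then have "\<alpha> z + u * \<beta> z = (1/2) *\<^sub>R
      ((1 - u * v) * (\<alpha> z + v * \<beta> z) + (1 + u * v) * (\<alpha> z - v * \<beta> z))"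
    by (simp only: scaleR_half_double)
  ultimately show ?thesis
    unfolding f[OF assms(5,3)] f[OF assms(5,4)] by (simp only: mult_scaleR_left scaleR_add_right[symmetric])
qed

lemma slice_map_measurable:
  assumes \<U>: "open \<U>" and v: "v \<in> quat_sphere"
  shows "slice_map v \<in> lebesgue_on \<U> \<rightarrow>\<^sub>M
    restrict_space borel (circularization \<U> \<inter> slice_plane v)"
proof (rule measurable_restrict_space2)
  have "slice_map v z \<in> slice_plane v" for z
    unfolding slice_plane_def slice_map_def by blast
  then show "slice_map v \<in> space (lebesgue_on \<U>) \<rightarrow> circularization \<U> \<inter> slice_plane v"
    using slice_map_circularization[OF v, of _ \<U>] by simp
  show "slice_map v \<in> borel_measurable (lebesgue_on \<U>)"
    using \<U> by (intro continuous_imp_measurable_on_sets_lebesgue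
        linear_continuous_on[OF bounded_linear_slice_map]) (simp add: borel_open)
qed

lemma slice_extension_reproducing:
  assumes \<U>: "open \<U>" "\<forall>z\<in>\<U>. cnj z \<in> \<U>" and K: "is_bergman_kernel \<U> K"
    and v: "v \<in> quat_sphere" and f: "slice_regular \<U> f"
    and int: "integrable (slice_measure \<U> v) (\<lambda>s. (norm (f s))\<^sup>2)"
    and q: "q \<in> circularization \<U>"
  shows "has_bochner_integral (slice_measure \<U> v) (\<lambda>s. slice_extension \<U> K q s * f s) (f q)"
proof -
  let ?S = "circularization \<U> \<inter> slice_plane v"
  note m = slice_map_measurable[OF \<U>(1) v]
  have cf: "continuous_on ?S f"
    by (rule slice_regular_continuous_on_slice[OF \<U> f v])
  have "continuous_on ?S (\<lambda>s. qcnj (slice_extension \<U> K s q))"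
    by (intro continuous_on_qcnj slice_regular_continuous_on_slice \<U> v slice_extension_kernel(1) K q)
  then have "continuous_on ?S (\<lambda>s. slice_extension \<U> K q s)"
    by (rule continuous_on_eq) (use slice_extension_hermitian[OF \<U> K q] in auto)
  then have meas: "(\<lambda>s. slice_extension \<U> K q s * f s) \<in> borel_measurable (restrict_space borel ?S)"
    by (intro borel_measurable_continuous_on_restrict continuous_intros cf)
  obtain u z where u: "u \<in> quat_sphere" and z: "z \<in> \<U>" and q_eq: "q = slice_map u z"
    using q by (rule circularization_cases)
  have "(\<lambda>s. (norm (f s))\<^sup>2) \<in> borel_measurable (restrict_space borel ?S)"
    by (intro borel_measurable_continuous_on_restrict continuous_intros cf)
  with int have int': "integrable (lebesgue_on \<U>) (\<lambda>w. (norm (f (slice_map v w)))\<^sup>2)"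
    unfolding slice_measure_def by (subst (asm) integrable_distr_eq[OF m])
  have rep: "has_bochner_integral (lebesgue_on \<U>) (\<lambda>w. slice_map v (K x w) * f (slice_map v w))
      (f (slice_map v x))" if "x \<in> \<U>" for x
    using slice_reproducing[OF \<U>(1) K v slice_regular_derivative[OF f \<U>(1) v] int' that] .
  have "has_bochner_integral (lebesgue_on \<U>) (\<lambda>w.
      ((1/2) *\<^sub>R (1 - u * v)) * (slice_map v (K z w) * f (slice_map v w)) +
      ((1/2) *\<^sub>R (1 + u * v)) * (slice_map v (K (cnj z) w) * f (slice_map v w)))
      (((1/2) *\<^sub>R (1 - u * v)) * f (slice_map v z) + ((1/2) *\<^sub>R (1 + u * v)) * f (slice_map v (cnj z)))"
    using rep z \<U>(2)
    by (intro has_bochner_integral_add has_bochner_integral_mult_right) auto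
  then have "has_bochner_integral (lebesgue_on \<U>) (\<lambda>w. slice_kernel K u z v w * f (slice_map v w)) (f q)"
    unfolding q_eq slice_regular_representation[OF f \<U>(2) u v z] slice_kernel_combination
    by (simp only: distrib_right mult.assoc)
  moreover have "slice_extension \<U> K q (slice_map v w) = slice_kernel K u z v w" if "w \<in> \<U>" for w
    unfolding q_eq
    using slice_extension_kernel(2)[OF \<U> K slice_map_circularization[OF v that] u z v that refl] .
  ultimately have "has_bochner_integral (lebesgue_on \<U>)
      (\<lambda>w. slice_extension \<U> K q (slice_map v w) * f (slice_map v w)) (f q)"
    by (subst has_bochner_integral_cong[OF refl _ refl]) auto
  then show ?thesis
    unfolding slice_measure_def by (rule has_bochner_integral_distr[OF meas m])
qed

theorem theorem7p6:
  fixes \<U> :: "complex set" and K :: "complex \<Rightarrow> complex \<Rightarrow> complex"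
  assumes "open \<U>" and "connected \<U>" and "\<forall>z\<in>\<U>. cnj z \<in> \<U>"
    and "is_bergman_kernel \<U> K"
  shows "(\<forall>q\<in>circularization \<U>. \<forall>s\<in>circularization \<U>.
            slice_extension \<U> K q s = qcnj (slice_extension \<U> K s q)) \<and>
         (\<forall>s\<in>circularization \<U>. slice_regular \<U> (\<lambda>q. slice_extension \<U> K q s)) \<and>
         (\<forall>q\<in>circularization \<U>. slice_antiregular \<U> (\<lambda>s. slice_extension \<U> K q s)) \<and>
         (\<forall>v\<in>quat_sphere. \<forall>f. slice_regular \<U> f \<and>
            integrable (slice_measure \<U> v) (\<lambda>s. (norm (f s))\<^sup>2) \<longrightarrow>
            (\<forall>q\<in>circularization \<U>.
               has_bochner_integral (slice_measure \<U> v)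
                 (\<lambda>s. slice_extension \<U> K q s * f s) (f q)))"
proof (intro conjI ballI allI impI)
  note a = assms(1,3,4)
  fix q s assume q: "q \<in> circularization \<U>"
  show "slice_antiregular \<U> (\<lambda>s. slice_extension \<U> K q s)"
    by (rule slice_extension_antiregular[OF a q])
  show "slice_regular \<U> (\<lambda>p. slice_extension \<U> K p q)"
    by (rule slice_extension_kernel(1)[OF a q])
  show "slice_extension \<U> K q s = qcnj (slice_extension \<U> K s q)" if "s \<in> circularization \<U>"
    by (rule slice_extension_hermitian[OF a q that])
  show "has_bochner_integral (slice_measure \<U> v) (\<lambda>s. slice_extension \<U> K q s * f s) (f q)"
    if "v \<in> quat_sphere"
      "slice_regular \<U> f \<and> integrable (slice_measure \<U> v) (\<lambda>s. (norm (f s))\<^sup>2)" for v f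
    using slice_extension_reproducing[OF a that(1) _ _ q] that(2) by simp
qed

end
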